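(* For every integer $n\geq 0$, the sum of the capacity values of all members of $\mathcal{B}_n$ (the set of compositions of $n$ with all parts in $\{1,2\}$) is given by $$\sum_{k=1}^n k\,w(n,k)=\frac{(n+1)L_{n+1}-f_n}{5}-2f_{n+1}+n+2,$$ where $w(n,k)$ is the number of members of $\mathcal{B}_n$ of capacity $k$, $f_n$ is the $n$-th Fibonacci number and $L_m=f_m+f_{m-2}$ for $m\geq 1$ is the $m$-th Lucas number.
   Context: A composition of $n$ is a finite sequence of positive integers (parts) with sum $n$; $\mathcal{B}_n$ denotes the set of compositions of $n$ with all parts in $\{1,2\}$, and $\mathcal{B}_0$ consists of the empty composition only. The capacity $\mathrm{cap}(\pi)$ of a composition $\pi$ is the number of water cells of its bargraph (the unit cells outside the bargraph, whose $i$-th column has height $\pi_i$, that would hold water). For $\pi=\pi_1\cdots\pi_m\in\mathcal{B}_n$ this equals the number of indices $i$ with $\pi_i=1$ such that $\pi_a=2$ for some $a<i$ and $\pi_b=2$ for some $b>i$. The Fibonacci numbers are indexed by $f_0=f_1=1$ and $f_n=f_{n-1}+f_{n-2}$ for $n\ge 2$, with $f_{-1}=0$ (so $L_1=1$). *)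

theory Defs
  imports Complex_Main "HOL-Number_Theory.Fib"
begin

definition compositions :: "nat \<Rightarrow> nat list set" where
  "compositions n = {p. sum_list p = n \<and> (\<forall>x\<in>set p. 0 < x)}"

definition B :: "nat \<Rightarrow> nat list set" where
  "B n = {p \<in> compositions n. set p \<subseteq> {1, 2}}"

text \<open>
  The pair (i, j) stands for the unit cell at height j in column i of the bargraph, where
  columns are counted from 0 and heights from 1. A cell above the top of its column holds
  water iff at its height the bargraph has a cell both to the left and to the right.
\<close>

definition water_cells :: "nat list \<Rightarrow> (nat \<times> nat) set" where
  "water_cells p = {(i, j). i < length p \<and> p ! i < j
     \<and> (\<exists>a<i. j \<le> p ! a) \<and> (\<exists>b>i. b < length p \<and> j \<le> p ! b)}"

definition capacity :: "nat list \<Rightarrow> nat" where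
  "capacity p = card (water_cells p)"

definition w :: "nat \<Rightarrow> nat \<Rightarrow> nat" where
  "w n k = card {p \<in> B n. capacity p = k}"

text \<open>
  The Fibonacci numbers are normalised by f 0 = f 1 = 1, whereas the library constant has
  fib 0 = 0 and fib 1 = 1; hence f n = fib (n + 1).
\<close>

definition f :: "nat \<Rightarrow> nat" where
  "f n = fib (n + 1)"

text \<open>
  The Lucas number L m is f m + f (m - 2) for m at least 1, where f has the value 0 at -1.
  The second summand is written as fib (m - 1), which also covers m = 1. The value at m = 0
  is not meaningful.
\<close>

definition L :: "nat \<Rightarrow> nat" where
  "L m = f m + fib (m - 1)"

lemma f_simps: "f 0 = 1" "f 1 = 1" "f (n + 2) = f (n + 1) + f n"
  by (simp_all add: f_def)

lemma L_simps: "L 1 = 1" "L (m + 2) = f (m + 2) + f m"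
  by (simp_all add: L_def f_def)

lemma capacity_B:
  assumes "p \<in> B n"
  shows "capacity p = card {i. i < length p \<and> p ! i = 1
    \<and> (\<exists>a<i. p ! a = 2) \<and> (\<exists>b>i. b < length p \<and> p ! b = 2)}" (is "_ = card ?I")
proof -
  have p12: "p ! i = 1 \<or> p ! i = 2" if "i < length p" for i
    using assms nth_mem[OF that] by (auto simp: B_def)
  have "(i, j) \<in> water_cells p \<longleftrightarrow> i \<in> ?I \<and> j = 2" for i j
  proof
    assume "(i, j) \<in> water_cells p"
    then obtain a b where i: "i < length p" "p ! i < j" and a: "a < i" "j \<le> p ! a"
      and b: "i < b" "b < length p" "j \<le> p ! b"
      by (auto simp: water_cells_def)
    have "p ! i = 1" "j = 2" "p ! a = 2" "p ! b = 2"
      using p12[of i] p12[of a] p12[of b] i a b by auto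
    then show "i \<in> ?I \<and> j = 2"
      using i a b by auto
  next
    assume "i \<in> ?I \<and> j = 2"
    then show "(i, j) \<in> water_cells p"
      by (fastforce simp: water_cells_def)
  qed
  then have "water_cells p = (\<lambda>i. (i, 2)) ` ?I"
    by auto
  then show ?thesis
    by (simp add: capacity_def card_image inj_on_def)
qed

end

theory Submission
  imports Defs
begin

text \<open>
  Strip the first part of a composition. A leading 1 neither holds water nor supports any, so
  it does not change the capacity; a leading 2 serves as left wall for the entire rest, so the
  rest then holds one cell of water on every 1 that still has a 2 to its right. Such a 1 is
  called sheltered (\<open>sheltered\<close>). Being sheltered depends on one side only, hence stripping a
  first part is harmless for this statistic too: a leading 1 counts iff the rest contains a 2,
  and a leading 2 never does.

  Write $S_n$ and $G_n$ for the sums of the capacity and of the number of sheltered 1s over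
  all members of $B_n$. Since $B_n$ has $f_n$ members and only one of them has no part 2,
  \[ S_{n+2} = S_{n+1} + G_n, \qquad G_{n+2} = G_{n+1} + G_n + f_{n+1} - 1 , \]
  with all initial values 0. The forcing term of the second recurrence solves the homogeneous
  equation up to a constant, so $G_n$ is a Fibonacci-type sequence with coefficients linear in
  $n$ plus a constant, see \<open>sum_sheltered\<close>; summing it gives the formula for $S_n$.
\<close>

section \<open>Compositions with parts 1 and 2\<close>

lemma Cons_in_B:
  "x # q \<in> B n \<longleftrightarrow> x = 1 \<and> (\<exists>m. n = Suc m \<and> q \<in> B m) \<or> x = 2 \<and> (\<exists>m. n = Suc (Suc m) \<and> q \<in> B m)"
  by (auto simp: B_def compositions_def)

lemma Nil_in_B: "[] \<in> B n \<longleftrightarrow> n = 0"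
  by (auto simp: B_def compositions_def)

lemma B_0: "B 0 = {[]}"
proof -
  have "p \<in> B 0 \<longleftrightarrow> p = []" for p
    by (cases p) (auto simp: Nil_in_B Cons_in_B)
  then show ?thesis by auto
qed

lemma B_1: "B (Suc 0) = {[1]}"
proof -
  have "p \<in> B (Suc 0) \<longleftrightarrow> p = [1]" for p
    by (cases p) (auto simp: Nil_in_B Cons_in_B B_0)
  then show ?thesis by auto
qed

lemma B_Suc_Suc: "B (Suc (Suc n)) = Cons 1 ` B (Suc n) \<union> Cons 2 ` B n"
proof -
  have "p \<in> B (Suc (Suc n)) \<longleftrightarrow> p \<in> Cons 1 ` B (Suc n) \<union> Cons 2 ` B n" for p
    by (cases p) (auto simp: Nil_in_B Cons_in_B)
  then show ?thesis by blast
qed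

lemma finite_B: "finite (B n)"
  by (induction n rule: fib.induct) (simp_all add: B_0 B_1 B_Suc_Suc)

lemma sum_B_Suc_Suc:
  "sum h (B (Suc (Suc n))) = (\<Sum>q\<in>B (Suc n). h (1 # q)) + (\<Sum>q\<in>B n. h (2 # q))"
proof -
  have "sum h (B (Suc (Suc n))) = sum h (Cons 1 ` B (Suc n)) + sum h (Cons 2 ` B n)"
    unfolding B_Suc_Suc by (rule sum.union_disjoint) (auto simp: finite_B)
  then show ?thesis
    by (simp add: sum.reindex)
qed

lemma card_B: "card (B n) = fib (Suc n)"
proof (induction n rule: fib.induct)
  case (3 n)
  then show ?case
    using sum_B_Suc_Suc[of "\<lambda>_. 1::nat" n] by simp
qed (simp_all add: B_0 B_1)

text \<open>The summand 1 accounts for the composition \<open>1 + \<dots> + 1\<close>, the only one without a part 2.\<close>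

lemma sum_contains_2: "(\<Sum>p\<in>B n. of_bool (2 \<in> set p)) + 1 = fib (Suc n)"
proof (induction n rule: fib.induct)
  case (3 n)
  then show ?case
    using sum_B_Suc_Suc[of "\<lambda>p. of_bool (2 \<in> set p) :: nat" n] by (simp add: card_B)
qed (simp_all add: B_0 B_1)

section \<open>Capacity and sheltered parts\<close>

definition sheltered :: "nat list \<Rightarrow> nat" where
  "sheltered q = card {i. i < length q \<and> q ! i = 1 \<and> (\<exists>b>i. b < length q \<and> q ! b = 2)}"

lemma ex_nat_0_Suc: "(\<exists>i. P i) \<longleftrightarrow> P 0 \<or> (\<exists>i. P (Suc i))"
  by (metis not0_implies_Suc)

lemma card_less_Suc_shift:
  "card {i. i < Suc m \<and> P i} = of_bool (P 0) + card {i. i < m \<and> P (Suc i)}"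
proof -
  have "{i. i < Suc m \<and> P i} = (if P 0 then {0} else {}) \<union> Suc ` {i. i < m \<and> P (Suc i)}"
    by (auto simp: less_Suc_eq_0_disj)
  then show ?thesis
    by (simp add: card_image)
qed

lemma sheltered_Nil: "sheltered [] = 0"
  by (simp add: sheltered_def)

lemma sheltered_Cons: "sheltered (x # q) = of_bool (x = 1 \<and> 2 \<in> set q) + sheltered q"
proof -
  have "(\<exists>b>Suc i. b < length (x # q) \<and> (x # q) ! b = 2) \<longleftrightarrow> (\<exists>b>i. b < length q \<and> q ! b = 2)" for i
    by (subst ex_nat_0_Suc) simp
  moreover have "(\<exists>b>0. b < length (x # q) \<and> (x # q) ! b = 2) \<longleftrightarrow> 2 \<in> set q"
    by (subst ex_nat_0_Suc) (auto simp: in_set_conv_nth)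
  ultimately show ?thesis
    by (simp add: sheltered_def card_less_Suc_shift)
qed

lemma capacity_Cons_1:
  assumes "q \<in> B n"
  shows "capacity (1 # q) = capacity q"
proof -
  have "1 # q \<in> B (Suc n)"
    using assms by (simp add: Cons_in_B)
  moreover have "(\<exists>a<Suc i. (1 # q) ! a = 2) \<longleftrightarrow> (\<exists>a<i. q ! a = 2)" for i
    by (subst ex_nat_0_Suc) simp
  moreover have "(\<exists>b>Suc i. b < length (1 # q) \<and> (1 # q) ! b = 2)
      \<longleftrightarrow> (\<exists>b>i. b < length q \<and> q ! b = 2)" for i
    by (subst ex_nat_0_Suc) simp
  ultimately show ?thesis
    using assms by (simp add: capacity_B card_less_Suc_shift)
qed

lemma capacity_Cons_2:
  assumes "q \<in> B n"
  shows "capacity (2 # q) = sheltered q"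
proof -
  have "2 # q \<in> B (Suc (Suc n))"
    using assms by (simp add: Cons_in_B)
  moreover have "\<exists>a<Suc i. (2 # q) ! a = 2" for i
    by (rule exI[of _ 0]) simp
  moreover have "(\<exists>b>Suc i. b < length (2 # q) \<and> (2 # q) ! b = 2)
      \<longleftrightarrow> (\<exists>b>i. b < length q \<and> q ! b = 2)" for i
    by (subst ex_nat_0_Suc) simp
  ultimately show ?thesis
    by (simp add: capacity_B sheltered_def card_less_Suc_shift)
qed

lemma capacity_le:
  assumes "p \<in> B n"
  shows "capacity p \<le> n"
proof -
  have "capacity p \<le> card {i. i < length p}"
    unfolding capacity_B[OF assms] by (rule card_mono) auto
  also have "\<dots> = length p"
    by simp
  also have "\<dots> \<le> sum_list p"
    using assms sum_list_mono[of p "\<lambda>_. 1" "\<lambda>x. x"]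
    by (simp add: B_def compositions_def Suc_le_eq sum_list_triv)
  also have "\<dots> = n"
    using assms by (simp add: B_def compositions_def)
  finally show ?thesis .
qed

section \<open>The recurrences and their solution\<close>

lemma sum_sheltered_Suc_Suc:
  "(\<Sum>p\<in>B (Suc (Suc n)). sheltered p) + 1
    = (\<Sum>p\<in>B (Suc n). sheltered p) + (\<Sum>p\<in>B n. sheltered p) + fib (Suc (Suc n))"
  using sum_contains_2[of "Suc n"] by (simp add: sum_B_Suc_Suc sheltered_Cons sum.distrib)

lemma sum_sheltered:
  "5 * real (\<Sum>p\<in>B n. sheltered p)
    = real n * (2 * real (fib n) + real (fib (Suc n))) - 3 * real (fib n) - 5 * real (fib (Suc n)) + 5"
proof (induction n rule: fib.induct)
  case (3 n)
  have "real (\<Sum>p\<in>B (Suc (Suc n)). sheltered p) = real (\<Sum>p\<in>B (Suc n). sheltered p)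
      + real (\<Sum>p\<in>B n. sheltered p) + real (fib (Suc (Suc n))) - 1"
    using arg_cong[OF sum_sheltered_Suc_Suc[of n], of real] by (simp del: fib.simps)
  then show ?case
    using 3 by (simp add: algebra_simps)
qed (simp_all add: B_0 B_1 sheltered_Nil sheltered_Cons)

lemma sum_capacity_Suc_Suc:
  "(\<Sum>p\<in>B (Suc (Suc n)). capacity p) = (\<Sum>p\<in>B (Suc n). capacity p) + (\<Sum>p\<in>B n. sheltered p)"
  by (simp add: sum_B_Suc_Suc capacity_Cons_1[simplified] capacity_Cons_2)

lemma sum_capacity:
  "real (\<Sum>p\<in>B n. capacity p)
    = (real (n + 1) * real (L (n + 1)) - real (f n)) / 5 - 2 * real (f (n + 1)) + real n + 2"
proof (induction n rule: fib.induct)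
  case (3 n)
  have "real (\<Sum>p\<in>B (Suc (Suc n)). capacity p)
      = real (\<Sum>p\<in>B (Suc n). capacity p) + real (\<Sum>p\<in>B n. sheltered p)"
    by (simp only: sum_capacity_Suc_Suc of_nat_add)
  then show ?case
    using 3 sum_sheltered[of n] by (simp add: f_def L_def field_simps)
next
  case 1
  show ?case
    using capacity_le[of "[]" 0] by (simp add: B_0 f_def L_def)
next
  case 2
  have "capacity [1] = capacity []"
    by (rule capacity_Cons_1[of _ 0]) (simp add: B_0)
  then show ?case
    using capacity_le[of "[]" 0] by (simp add: B_0 B_1 f_def L_def)
qed

text \<open>Grouping by capacity loses nothing: capacities are at most \<open>n\<close>, and capacity 0 adds 0.\<close>

lemma sum_capacity_by_value: "(\<Sum>p\<in>B n. capacity p) = (\<Sum>k=1..n. k * w n k)"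
proof -
  have "(\<Sum>p\<in>B n. capacity p) = (\<Sum>k\<in>{0..n}. \<Sum>p\<in>{p \<in> B n. capacity p = k}. capacity p)"
    by (rule sum.group[symmetric]) (auto simp: finite_B capacity_le)
  also have "\<dots> = (\<Sum>k\<in>{0..n}. k * w n k)"
    by (rule sum.cong) (simp_all add: w_def)
  also have "\<dots> = (\<Sum>k=1..n. k * w n k)"
    by (simp add: sum.atLeast_Suc_atMost)
  finally show ?thesis .
qed

theorem theorem2:
  fixes n :: nat
  shows "(\<Sum>p\<in>B n. capacity p) = (\<Sum>k=1..n. k * w n k)
    \<and> real (\<Sum>k=1..n. k * w n k)
      = (real (n + 1) * real (L (n + 1)) - real (f n)) / 5 - 2 * real (f (n + 1)) + real n + 2"
  using sum_capacity[of n] by (simp only: sum_capacity_by_value)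

end
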